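(* Let $X$ be a compact space and $Y$ a scattered compact space such that $X$ or $Y$ satisfies the countable chain condition, and let $f:X\times Y\to\overline{\mathbb R}$ be a separately continuous function. Then $(\wedge_f,\vee_f)$ is a stable pair of Hahn on $X$.
   Context: Compact spaces are Hausdorff; $Y$ is scattered if every non-empty subset has a point isolated in it. The countable chain condition means every family of pairwise disjoint non-empty open sets is countable. $\overline{\mathbb R}=[-\infty,+\infty]$. $\wedge_f(x)=\inf_{y\in Y}f(x,y)$, $\vee_f(x)=\sup_{y\in Y}f(x,y)$. A pair $(g,h)$ of functions $X\to\overline{\mathbb R}$ is a stable pair of Hahn if there are continuous $u_n:X\to\overline{\mathbb R}$ with $g(x)=\min_{n\in\mathbb N}u_n(x)$ and $h(x)=\max_{n\in\mathbb N}u_n(x)$ for all $x\in X$ (attained). *)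

theory Defs
  imports "HOL-Analysis.Analysis" "HOL-Library.Extended_Real"
begin

definition scattered_space :: "'a topology \<Rightarrow> bool" where
  "scattered_space Y \<longleftrightarrow>
     (\<forall>S. S \<subseteq> topspace Y \<and> S \<noteq> {} \<longrightarrow>
        (\<exists>y\<in>S. \<exists>U. openin Y U \<and> U \<inter> S = {y}))"

definition ccc_space :: "'a topology \<Rightarrow> bool" where
  "ccc_space X \<longleftrightarrow>
     (\<forall>\<U>. (\<forall>U\<in>\<U>. openin X U \<and> U \<noteq> {}) \<and> pairwise disjnt \<U> \<longrightarrow> countable \<U>)"

definition separately_continuous ::
  "'a topology \<Rightarrow> 'b topology \<Rightarrow> ('a \<Rightarrow> 'b \<Rightarrow> ereal) \<Rightarrow> bool" where
  "separately_continuous X Y f \<longleftrightarrow>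
     (\<forall>y\<in>topspace Y. continuous_map X euclidean (\<lambda>x. f x y)) \<and>
     (\<forall>x\<in>topspace X. continuous_map Y euclidean (\<lambda>y. f x y))"

definition inf_f :: "'b topology \<Rightarrow> ('a \<Rightarrow> 'b \<Rightarrow> ereal) \<Rightarrow> 'a \<Rightarrow> ereal" where
  "inf_f Y f x = (INF y\<in>topspace Y. f x y)"

definition sup_f :: "'b topology \<Rightarrow> ('a \<Rightarrow> 'b \<Rightarrow> ereal) \<Rightarrow> 'a \<Rightarrow> ereal" where
  "sup_f Y f x = (SUP y\<in>topspace Y. f x y)"

definition stable_Hahn_pair ::
  "'a topology \<Rightarrow> ('a \<Rightarrow> ereal) \<Rightarrow> ('a \<Rightarrow> ereal) \<Rightarrow> bool" where
  "stable_Hahn_pair X g h \<longleftrightarrow>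
     (\<exists>u :: nat \<Rightarrow> 'a \<Rightarrow> ereal.
        (\<forall>n. continuous_map X euclidean (u n)) \<and>
        (\<forall>x\<in>topspace X.
           (\<exists>n. u n x = g x) \<and> (\<forall>n. g x \<le> u n x) \<and>
           (\<exists>n. u n x = h x) \<and> (\<forall>n. u n x \<le> h x)))"

end

theory Submission
  imports Defs
begin

text \<open>
  It suffices that the slices f(_, y) are only countably many: enumerating them gives the
  functions u_n, and the extrema are attained because each f(x, _) is continuous on the compact
  space Y. Countability follows once a countable set E of points of X separates the slices: every
  point of Y then has a neighbourhood meeting countably many slices, because the points off a given
  slice form an F-sigma set (induction along the scattered space Y).

  If Y is ccc, its isolated points form a countable dense set D. The map sending x to the values
  f(x, d), d in D, has compact metrizable image, through which every slice factors; E lifts a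
  countable dense subset of that image. If X is ccc, a Namioka-type argument shows that every
  non-empty open set of X contains a non-empty open set on which all slices simultaneously
  oscillate by at most e. For each e = 1/n, a maximal disjoint family of such sets is countable, and
  choosing a point in each member gives E.
\<close>

section \<open>Compactness and closed-set induction in scattered spaces\<close>

text \<open>The closed sets that contain almost all \<open>a n\<close> have the finite intersection
  property. The cluster point \<open>p\<close> replaces the limit of a subsequence, which a general
  compact space need not provide.\<close>

lemma compact_space_cluster_point:
  fixes a :: "nat \<Rightarrow> 'a"
  assumes "compact_space X" and "\<And>n. a n \<in> topspace X"
  obtains p where "\<And>C m. closedin X C \<Longrightarrow> (\<And>n. m \<le> n \<Longrightarrow> a n \<in> C) \<Longrightarrow> p \<in> C"
proof -
  define \<U> where "\<U> = {C. closedin X C \<and> (\<forall>\<^sub>F n in sequentially. a n \<in> C)}"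
  have "\<Inter>\<F> \<noteq> {}" if "finite \<F>" "\<F> \<subseteq> \<U>" for \<F>
  proof -
    have "\<forall>\<^sub>F n in sequentially. \<forall>C\<in>\<F>. a n \<in> C"
      using that by (intro eventually_ball_finite) (auto simp: \<U>_def)
    then obtain n where "\<forall>C\<in>\<F>. a n \<in> C"
      by (auto simp: eventually_sequentially)
    then show ?thesis by blast
  qed
  moreover have "\<forall>C\<in>\<U>. closedin X C" by (simp add: \<U>_def)
  ultimately have "\<Inter>\<U> \<noteq> {}"
    using compact_space_fip[THEN iffD1, OF assms(1), rule_format, of \<U>] by simp
  then obtain p where "p \<in> \<Inter>\<U>" by blast
  then show ?thesis
    by (intro that[of p]) (auto simp: \<U>_def eventually_sequentially)
qed

lemma compact_Hausdorff_shrink_open: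
  assumes "compact_space X" "Hausdorff_space X" "openin X U" "p \<in> U"
  obtains V C where "openin X V" "closedin X C" "p \<in> V" "V \<subseteq> C" "C \<subseteq> U"
proof -
  have "neighbourhood_base_of (closedin X) X"
    using compact_Hausdorff_imp_regular_space[OF assms(1,2)] neighbourhood_base_of_closedin by blast
  then show thesis
    using that assms(3,4) unfolding neighbourhood_base_of by metis
qed

text \<open>The union of all open sets satisfying \<open>P\<close> must be everything, since otherwise its
  complement has an isolated point, near which \<open>step\<close> applies.\<close>

lemma scattered_closed_induct:
  assumes cpt: "compact_space Y" and Haus: "Hausdorff_space Y" and scat: "scattered_space Y"
    and empty: "P {}"
    and Un: "\<And>K L. P K \<Longrightarrow> P L \<Longrightarrow> P (K \<union> L)"
    and mono: "\<And>K L. P K \<Longrightarrow> L \<subseteq> K \<Longrightarrow> P L"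
    and step: "\<And>K y. closedin Y K \<Longrightarrow> y \<in> K \<Longrightarrow> (\<And>L. closedin Y L \<Longrightarrow> L \<subseteq> K - {y} \<Longrightarrow> P L) \<Longrightarrow> P K"
  shows "P (topspace Y)"
proof -
  define \<W> where "\<W> = {W. openin Y W \<and> P W}"
  have fin: "P (\<Union>\<F>)" if "finite \<F>" "\<F> \<subseteq> \<W>" for \<F>
    using that by induction (auto simp: \<W>_def empty Un)
  have covered: "P L" if L: "closedin Y L" "L \<subseteq> \<Union>\<W>" for L
  proof -
    obtain \<F> where "finite \<F>" "\<F> \<subseteq> \<W>" "L \<subseteq> \<Union>\<F>"
      using compactinD[OF closedin_compact_space[OF cpt L(1)], of \<W>] L(2)
      by (auto simp: \<W>_def)
    then show ?thesis using mono[OF fin] by blast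
  qed
  have "topspace Y \<subseteq> \<Union>\<W>"
  proof (rule ccontr)
    assume "\<not> topspace Y \<subseteq> \<Union>\<W>"
    then have "topspace Y - \<Union>\<W> \<subseteq> topspace Y" "topspace Y - \<Union>\<W> \<noteq> {}" by auto
    then obtain y U where yU: "y \<in> topspace Y - \<Union>\<W>" "openin Y U" "U \<inter> (topspace Y - \<Union>\<W>) = {y}"
      using scat[unfolded scattered_space_def, rule_format, OF conjI] by metis
    \<comment> \<open>A closed neighbourhood \<open>K\<close> of \<open>y\<close> inside
      \<open>U\<close> meets the uncovered set only in \<open>y\<close>, so any closed part of
      \<open>K\<close> avoiding \<open>y\<close> is compact and covered by finitely many members of
      \<open>\<W>\<close>.\<close>
    obtain V K where V: "openin Y V" "closedin Y K" "y \<in> V" "V \<subseteq> K" "K \<subseteq> U"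
      using compact_Hausdorff_shrink_open[OF cpt Haus yU(2), of y] yU(3) by blast
    have "P K"
    proof (rule step[of K y])
      fix L assume L: "closedin Y L" "L \<subseteq> K - {y}"
      have "L \<subseteq> \<Union>\<W>"
        proof
        fix x assume "x \<in> L"
        then have "x \<in> U" "x \<noteq> y" "x \<in> topspace Y" using V(5) L(2) closedin_subset[OF L(1)] by auto
        then show "x \<in> \<Union>\<W>" using yU(3) by fastforce
      qed
      then show "P L" using covered L(1) by blast
    qed (use V in auto)
    then have "V \<in> \<W>" using mono[OF _ V(4)] V(1) by (simp add: \<W>_def)
    then show False using yU(1) V(3) by blast
  qed
  then show ?thesis by (intro covered) auto
qed

section \<open>Level sets of real functions and a bounded real copy of the extended reals\<close>

lemma
  fixes h :: "'a \<Rightarrow> real"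
  assumes "continuous_map X euclidean h"
  shows closedin_Collect_le_const: "closedin X {x \<in> topspace X. h x \<le> c}"
    and closedin_Collect_ge_const: "closedin X {x \<in> topspace X. c \<le> h x}"
    and openin_Collect_less_const: "openin X {x \<in> topspace X. h x < c}"
    and openin_Collect_greater_const: "openin X {x \<in> topspace X. c < h x}"
  using closedin_continuous_map_preimage[OF assms, of "{..c}"]
    closedin_continuous_map_preimage[OF assms, of "{c..}"]
    openin_continuous_map_preimage[OF assms, of "{..<c}"]
    openin_continuous_map_preimage[OF assms, of "{c<..}"] by simp_all

lemma continuous_map_abs_diff:
  fixes g h :: "'a \<Rightarrow> real"
  assumes "continuous_map X euclidean g" "continuous_map X euclidean h"
  shows "continuous_map X euclidean (\<lambda>x. \<bar>g x - h x\<bar>)"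
  using assms by (intro continuous_map_real_abs continuous_map_diff)

text \<open>The extension of \<open>arctan\<close> by its limits. Passing to real values makes
  differences available for measuring how slices vary.\<close>

definition ereal_squash :: "ereal \<Rightarrow> real" where
  "ereal_squash x =
     (if x = \<infinity> then pi/2 else if x = -\<infinity> then -(pi/2) else arctan (real_of_ereal x))"

lemma inj_ereal_squash: "inj ereal_squash"
proof (rule injI)
  have "arctan r < pi/2" "-(pi/2) < arctan r" for r
    using arctan_lbound[of r] arctan_ubound[of r] by linarith+
  note * = this[THEN less_imp_neq]
  have **: "-(pi/2) \<noteq> pi/2" using pi_gt_zero by linarith
  fix x y assume eq: "ereal_squash x = ereal_squash y"
  have real: "ereal_squash (ereal r) = arctan r" for r by (simp add: ereal_squash_def)
  have inf: "ereal_squash \<infinity> = pi/2" "ereal_squash (-\<infinity>) = -(pi/2)"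
    by (simp_all add: ereal_squash_def)
  show "x = y"
    by (cases x; cases y; insert eq)
      (simp_all only: real inf arctan_eq_iff * *[symmetric] ** **[symmetric])
qed

lemma continuous_ereal_squash: "continuous_on UNIV ereal_squash"
proof -
  have "(ereal_squash \<longlongrightarrow> ereal_squash x) (at x)" for x
  proof (cases x)
    case (real r)
    have "(arctan \<longlongrightarrow> arctan r) (at r)" by (intro tendsto_intros)
    then show ?thesis
      by (simp add: real at_ereal filterlim_filtermap ereal_squash_def)
  next
    case PInf
    \<comment> \<open>Nothing lies above infinity, so its punctured neighbourhood filter is the
      left-hand one, which is the image of \<open>at_top\<close>.\<close>
    have "{\<infinity>::ereal<..} = {}" by auto
    then have "at (\<infinity>::ereal) = filtermap ereal at_top"
      using at_eq_sup_left_right[of "\<infinity>::ereal"] by (simp add: at_left_PInf)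
    then show ?thesis using tendsto_arctan_at_top
      by (simp add: PInf filterlim_filtermap ereal_squash_def)
  next
    case MInf
    have "{..<-\<infinity>::ereal} = {}" by auto
    then have "at (-\<infinity>::ereal) = filtermap ereal at_bot"
      using at_eq_sup_left_right[of "-\<infinity>::ereal"] by (simp add: at_right_MInf)
    then show ?thesis using tendsto_arctan_at_bot
      by (simp add: MInf filterlim_filtermap ereal_squash_def)
  qed
  then show ?thesis by (simp add: continuous_on_def)
qed

section \<open>Countable dense sets, separating points and slices\<close>

text \<open>The isolated points serve: their singletons are disjoint and open, and a point isolated
  in a non-empty open set is isolated in the whole space.\<close>

lemma scattered_ccc_countable_dense:
  assumes "scattered_space Y" and "ccc_space Y"
  obtains D where "countable D" "D \<subseteq> topspace Y" "Y closure_of D = topspace Y"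
proof -
  define D where "D = {y. openin Y {y}}"
  have "pairwise disjnt ((\<lambda>y. {y}) ` D)"
    by (auto simp: pairwise_def disjnt_def)
  moreover have "\<forall>U\<in>(\<lambda>y. {y}) ` D. openin Y U \<and> U \<noteq> {}"
    by (auto simp: D_def)
  ultimately have "countable ((\<lambda>y. {y}) ` D)"
    using assms(2)[unfolded ccc_space_def, rule_format] by simp
  then have "countable D"
    by (rule countable_image_inj_on) simp
  moreover have "D \<subseteq> topspace Y"
    using openin_subset by (fastforce simp: D_def)
  moreover have "D \<inter> T \<noteq> {}" if T: "openin Y T" "T \<noteq> {}" for T
  proof -
    obtain y U where "y \<in> T" "openin Y U" "U \<inter> T = {y}"
      using assms(1)[unfolded scattered_space_def, rule_format, of T] T openin_subset[OF T(1)] by auto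
    then have "y \<in> D \<inter> T" using openin_Int[of Y U T] T(1) by (simp add: D_def)
    then show ?thesis by blast
  qed
  ultimately show thesis
    using that[of D] by (simp add: dense_intersects_open)
qed

text \<open>Points of \<open>K\<close> whose slice differs from that of \<open>y\<close> on
  \<open>E\<close> are covered by countably many closed sets avoiding \<open>y\<close>, to which the
  induction hypothesis applies; all other points of \<open>K\<close> share the slice of
  \<open>y\<close>. Slices are restricted so that equality of functions means agreement on the
  space.\<close>

lemma countable_slices_if_separated:
  fixes F :: "'a \<Rightarrow> 'b \<Rightarrow> real"
  assumes Y: "compact_space Y" "Hausdorff_space Y" "scattered_space Y"
    and contY: "\<And>x. x \<in> topspace X \<Longrightarrow> continuous_map Y euclidean (F x)"
    and E: "countable E" "E \<subseteq> topspace X"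
    and sep: "\<And>y y' x. \<lbrakk>y \<in> topspace Y; y' \<in> topspace Y; x \<in> topspace X;
                \<forall>e\<in>E. F e y = F e y'\<rbrakk> \<Longrightarrow> F x y = F x y'"
  shows "countable ((\<lambda>y. restrict (\<lambda>x. F x y) (topspace X)) ` topspace Y)"
proof -
  let ?g = "\<lambda>y. restrict (\<lambda>x. F x y) (topspace X)"
  show ?thesis
  proof (rule scattered_closed_induct[OF Y, where P = "\<lambda>K. countable (?g ` K)"])
    show "countable (?g ` L)" if "countable (?g ` K)" "L \<subseteq> K" for K L
      using that by (meson countable_subset image_mono)
  next
    fix K y
    assume K: "closedin Y K" and y: "y \<in> K"
      and IH: "\<And>L. closedin Y L \<Longrightarrow> L \<subseteq> K - {y} \<Longrightarrow> countable (?g ` L)"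
    have KY: "K \<subseteq> topspace Y" using K closedin_subset by blast
    define L where "L e n = K \<inter> {z \<in> topspace Y. inverse (Suc n) \<le> \<bar>F e z - F e y\<bar>}" for e n
    have "countable (?g ` L e n)" if "e \<in> E" for e n
    proof (rule IH)
      have "continuous_map Y euclidean (\<lambda>z. \<bar>F e z - F e y\<bar>)"
        using contY that E(2) by (intro continuous_map_abs_diff) auto
      then show "closedin Y (L e n)"
        unfolding L_def by (intro closedin_Int K closedin_Collect_ge_const)
      show "L e n \<subseteq> K - {y}" by (auto simp: L_def)
    qed
    then have "countable (insert (?g y) (\<Union>e\<in>E. \<Union>n. ?g ` L e n))"
      using E(1) by (intro countable_insert countable_UN) auto
    moreover have "?g ` K \<subseteq> insert (?g y) (\<Union>e\<in>E. \<Union>n. ?g ` L e n)"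
    proof
      fix w assume "w \<in> ?g ` K"
      then obtain z where z: "z \<in> K" "w = ?g z" by blast
      show "w \<in> insert (?g y) (\<Union>e\<in>E. \<Union>n. ?g ` L e n)"
      proof (cases "\<forall>e\<in>E. F e z = F e y")
        case True
        then have "?g z = ?g y"
          using sep[of z y] z(1) y KY by (intro restrict_ext) blast
        then show ?thesis using z(2) by simp
      next
        case False
        then obtain e where e: "e \<in> E" "0 < \<bar>F e z - F e y\<bar>" by auto
        then obtain n where "inverse (Suc n) < \<bar>F e z - F e y\<bar>"
          using reals_Archimedean by blast
        then have "z \<in> L e n" using z(1) KY by (auto simp: L_def)
        then show ?thesis using e(1) z(2) by blast
      qed
    qed
    ultimately show "countable (?g ` K)" using countable_subset by blast
  qed (auto simp: image_Un)
qed

lemma dense_points_separate_slices: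
  fixes F :: "'a \<Rightarrow> 'b \<Rightarrow> real"
  assumes X: "compact_space X"
    and contX: "\<And>y. y \<in> topspace Y \<Longrightarrow> continuous_map X euclidean (\<lambda>x. F x y)"
    and contY: "\<And>x. x \<in> topspace X \<Longrightarrow> continuous_map Y euclidean (F x)"
    and D: "countable D" "D \<subseteq> topspace Y" "Y closure_of D = topspace Y" "topspace Y \<noteq> {}"
  obtains E where "countable E" "E \<subseteq> topspace X"
    "\<And>y y' x. \<lbrakk>y \<in> topspace Y; y' \<in> topspace Y; x \<in> topspace X;
      \<forall>e\<in>E. F e y = F e y'\<rbrakk> \<Longrightarrow> F x y = F x y'"
proof -
  have "D \<noteq> {}" using D(3,4) closure_of_empty[of Y] by metis
  \<comment> \<open>An enumeration of \<open>D\<close>, with repetitions if \<open>D\<close> is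
    finite, turns the values on \<open>D\<close> into a real sequence; the space of these has a
    countable basis.\<close>
  define d where "d = from_nat_into D"
  have d: "range d = D" using \<open>D \<noteq> {}\<close> D(1) unfolding d_def by (rule range_from_nat_into)
  then have dY: "d n \<in> topspace Y" for n using D(2) by blast
  define h where "h x n = F x (d n)" for x n
  have conth: "continuous_map X euclidean h"
    using contX dY unfolding euclidean_product_topology[symmetric]
    by (simp add: continuous_map_componentwise_UNIV h_def)
  \<comment> \<open>Every slice factors through \<open>h\<close>: the continuous functions
    \<open>F x\<close> and \<open>F x'\<close> agree on the dense set \<open>D\<close>.\<close>
  have inv: "F x y = F x' y"
    if xx: "x \<in> topspace X" "x' \<in> topspace X" "h x = h x'" and y: "y \<in> topspace Y" for x x' y
  proof -
    have cl: "closedin Y {y \<in> topspace Y. \<bar>F x y - F x' y\<bar> \<le> 0}"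
      using contY xx by (intro closedin_Collect_le_const continuous_map_abs_diff) auto
    have "D \<subseteq> {y \<in> topspace Y. \<bar>F x y - F x' y\<bar> \<le> 0}"
      using D(2) d xx(3) by (auto simp: h_def fun_eq_iff)
    then have "Y closure_of D \<subseteq> {y \<in> topspace Y. \<bar>F x y - F x' y\<bar> \<le> 0}"
      using cl closure_of_minimal by blast
    then show ?thesis using y D(3) by auto
  qed
  obtain \<B> :: "(nat \<Rightarrow> real) set set" where B: "countable \<B>" "topological_basis \<B>"
    using ex_countable_basis by blast
  \<comment> \<open>One point of \<open>X\<close> is chosen over each basic open set that meets the
    image of \<open>h\<close>, so the images of these points are dense in that image.\<close>
  define c where "c V = (SOME x. x \<in> topspace X \<and> h x \<in> V)" for V
  define \<B>' where "\<B>' = {V \<in> \<B>. \<exists>x\<in>topspace X. h x \<in> V}"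
  have c: "c V \<in> topspace X \<and> h (c V) \<in> V" if "V \<in> \<B>'" for V
    unfolding c_def by (rule someI_ex) (use that in \<open>auto simp: \<B>'_def\<close>)
  show thesis
  proof
    show "countable (c ` \<B>')" using B(1) by (simp add: \<B>'_def)
    show "c ` \<B>' \<subseteq> topspace X" using c by blast
    fix y y' x
    assume y: "y \<in> topspace Y" "y' \<in> topspace Y" and x: "x \<in> topspace X"
      and eq: "\<forall>e\<in>c ` \<B>'. F e y = F e y'"
    \<comment> \<open>By \<open>inv\<close>, a point outside the agreement set \<open>A\<close> is
      mapped outside the closed image of \<open>A\<close>. A basic open set around its value that
      misses this image would contain the value of a chosen point, which lies in
      \<open>A\<close>.\<close>
    define A where "A = {x \<in> topspace X. \<bar>F x y - F x y'\<bar> \<le> 0}"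
    have "closedin X A"
      unfolding A_def using contX y by (intro closedin_Collect_le_const continuous_map_abs_diff) auto
    then have "compact (h ` A)"
      using image_compactin[OF closedin_compact_space[OF X] conth] by simp
    then have "open (- h ` A)" by (simp add: compact_imp_closed open_Compl)
    show "F x y = F x y'"
    proof (rule ccontr)
      assume ne: "F x y \<noteq> F x y'"
      have "h x \<in> - h ` A"
      proof
        assume "h x \<in> h ` A"
        then obtain a where "a \<in> A" "h x = h a" by blast
        then show False using inv[of x a] x y ne by (auto simp: A_def)
      qed
      then obtain V where V: "V \<in> \<B>" "h x \<in> V" "V \<subseteq> - h ` A"
        using topological_basisE[OF B(2) \<open>open (- h ` A)\<close>] by metis
      then have "V \<in> \<B>'" using x by (auto simp: \<B>'_def)
      then show False using c[of V] V(3) eq by (auto simp: A_def)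
    qed
  qed
qed

section \<open>Simultaneous small oscillation and the case of ccc \<open>X\<close>\<close>

text \<open>Zorn's lemma under inclusion: a non-empty set disjoint from all of \<open>M\<close>
  could be added to \<open>M\<close>. The empty set must be excluded, being disjoint from
  everything.\<close>

lemma exists_maximal_disjoint_subfamily:
  assumes "{} \<notin> \<P>"
  shows "\<exists>M\<subseteq>\<P>. pairwise disjnt M \<and> (\<forall>V\<in>\<P>. \<exists>W\<in>M. \<not> disjnt V W)"
proof -
  let ?A = "{M. M \<subseteq> \<P> \<and> pairwise disjnt M}"
  have "\<exists>M\<in>?A. \<forall>N\<in>?A. M \<subseteq> N \<longrightarrow> N = M"
  proof (rule subset_Zorn')
    fix C assume "subset.chain ?A C"
    then have C: "C \<subseteq> ?A" "\<And>M N. M \<in> C \<Longrightarrow> N \<in> C \<Longrightarrow> M \<subseteq> N \<or> N \<subseteq> M"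
      by (auto simp: subset_chain_def)
    have "disjnt V W" if VW: "V \<in> \<Union>C" "W \<in> \<Union>C" "V \<noteq> W" for V W
    proof -
      obtain M N where "M \<in> C" "V \<in> M" "N \<in> C" "W \<in> N" using VW by blast
      then obtain L where "L \<in> C" "V \<in> L" "W \<in> L" using C(2) by blast
      moreover have "pairwise disjnt L" using C(1) \<open>L \<in> C\<close> by blast
      ultimately show ?thesis using VW(3) by (meson pairwiseD)
    qed
    then show "\<Union>C \<in> ?A" using C(1) by (auto simp: pairwise_def)
  qed
  then obtain M where "M \<in> ?A" "\<forall>N\<in>?A. M \<subseteq> N \<longrightarrow> N = M" by (rule bexE)
  then have M: "M \<subseteq> \<P>" "pairwise disjnt M"
    and max: "\<And>N. N \<subseteq> \<P> \<Longrightarrow> pairwise disjnt N \<Longrightarrow> M \<subseteq> N \<Longrightarrow> N = M" by simp_all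
  show ?thesis
  proof (intro exI[of _ M] conjI ballI M)
    fix V assume "V \<in> \<P>"
    then have V: "V \<in> \<P>" "V \<noteq> {}" using assms by auto
    show "\<exists>W\<in>M. \<not> disjnt V W"
    proof (rule ccontr)
      assume *: "\<not> (\<exists>W\<in>M. \<not> disjnt V W)"
      then have "pairwise disjnt (insert V M)"
        using M(2) by (auto simp: pairwise_insert disjnt_sym)
      then have "insert V M = M" using max[of "insert V M"] M V by blast
      then show False using * V(2) by (auto simp: disjnt_def)
    qed
  qed
qed

text \<open>A Namioka-type equicontinuity, with one \<open>V\<close> for all of \<open>K\<close>. It
  is stated inside every open \<open>U\<close> instead of at points, so that it passes to unions by
  shrinking twice.\<close>

definition small_oscillation_on :: "'a topology \<Rightarrow> ('a \<Rightarrow> 'b \<Rightarrow> real) \<Rightarrow> 'b set \<Rightarrow> bool" where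
  "small_oscillation_on X F K \<longleftrightarrow>
     (\<forall>U e. openin X U \<and> U \<noteq> {} \<and> 0 < e \<longrightarrow>
        (\<exists>V. openin X V \<and> V \<noteq> {} \<and> V \<subseteq> U \<and>
             (\<forall>x\<in>V. \<forall>x'\<in>V. \<forall>y\<in>K. \<bar>F x y - F x' y\<bar> \<le> e)))"

lemma small_oscillation_onD:
  assumes "small_oscillation_on X F K" "openin X U" "U \<noteq> {}" "0 < e"
  obtains V where "openin X V" "V \<noteq> {}" "V \<subseteq> U"
    "\<And>x x' y. \<lbrakk>x \<in> V; x' \<in> V; y \<in> K\<rbrakk> \<Longrightarrow> \<bar>F x y - F x' y\<bar> \<le> e"
  using assms unfolding small_oscillation_on_def by metis

lemma small_oscillation_on_Un:
  assumes "small_oscillation_on X F K" "small_oscillation_on X F L"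
  shows "small_oscillation_on X F (K \<union> L)"
  unfolding small_oscillation_on_def
proof (intro allI impI)
  fix U and e :: real
  assume U: "openin X U \<and> U \<noteq> {} \<and> 0 < e"
  obtain V where V: "openin X V" "V \<noteq> {}" "V \<subseteq> U"
    "\<And>x x' y. \<lbrakk>x \<in> V; x' \<in> V; y \<in> K\<rbrakk> \<Longrightarrow> \<bar>F x y - F x' y\<bar> \<le> e"
    using small_oscillation_onD[OF assms(1)] U by metis
  obtain W where W: "openin X W" "W \<noteq> {}" "W \<subseteq> V"
    "\<And>x x' y. \<lbrakk>x \<in> W; x' \<in> W; y \<in> L\<rbrakk> \<Longrightarrow> \<bar>F x y - F x' y\<bar> \<le> e"
    using small_oscillation_onD[OF assms(2) V(1,2)] U by metis
  show "\<exists>V. openin X V \<and> V \<noteq> {} \<and> V \<subseteq> U \<and>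
             (\<forall>x\<in>V. \<forall>x'\<in>V. \<forall>y\<in>K \<union> L. \<bar>F x y - F x' y\<bar> \<le> e)"
  proof (intro exI[of _ W] conjI ballI)
    show "\<bar>F x y - F x' y\<bar> \<le> e" if "x \<in> W" "x' \<in> W" "y \<in> K \<union> L" for x x' y
      using that V(4)[of x x' y] W(3) W(4)[of x x' y] by auto
  qed (use V W in auto)
qed

text \<open>Grothendieck's double limit argument, with cluster points in place of limits.\<close>

lemma double_limit_separation:
  fixes h :: "'a \<Rightarrow> 'b \<Rightarrow> real" and x :: "nat \<Rightarrow> 'a" and z :: "nat \<Rightarrow> 'b"
  assumes X: "compact_space X" and Y: "compact_space Y"
    and contX: "\<And>y. y \<in> topspace Y \<Longrightarrow> continuous_map X euclidean (\<lambda>x. h x y)"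
    and contY: "\<And>x. x \<in> topspace X \<Longrightarrow> continuous_map Y euclidean (h x)"
    and x: "\<And>n. x n \<in> topspace X" and z: "\<And>n. z n \<in> topspace Y"
    and small: "\<And>m n. m < n \<Longrightarrow> \<bar>h (x m) (z n)\<bar> \<le> a"
    and large: "\<And>m n. n \<le> m \<Longrightarrow> b \<le> \<bar>h (x m) (z n)\<bar>"
  shows "b \<le> a"
proof -
  obtain p where p: "\<And>C m. closedin X C \<Longrightarrow> (\<And>n. m \<le> n \<Longrightarrow> x n \<in> C) \<Longrightarrow> p \<in> C"
    using compact_space_cluster_point[of X x, OF X x] by metis
  obtain q where q: "\<And>C m. closedin Y C \<Longrightarrow> (\<And>n. m \<le> n \<Longrightarrow> z n \<in> C) \<Longrightarrow> q \<in> C"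
    using compact_space_cluster_point[of Y z, OF Y z] by metis
  have pX: "p \<in> topspace X" using p[OF closedin_topspace, of 0] x by blast
  have qY: "q \<in> topspace Y" using q[OF closedin_topspace, of 0] z by blast
  \<comment> \<open>Limits are taken in both orders: for the bound \<open>a\<close> first in
    \<open>n\<close> and then in \<open>m\<close>, for the bound \<open>b\<close> first in
    \<open>m\<close> and then in \<open>n\<close>. Both arrive at the value
    \<open>h p q\<close>.\<close>
  have "q \<in> {y \<in> topspace Y. \<bar>h (x m) y\<bar> \<le> a}" for m
  proof (rule q)
    show "closedin Y {y \<in> topspace Y. \<bar>h (x m) y\<bar> \<le> a}"
      by (intro closedin_Collect_le_const continuous_map_real_abs contY x)
    show "z n \<in> {y \<in> topspace Y. \<bar>h (x m) y\<bar> \<le> a}" if "Suc m \<le> n" for n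
      using small[of m n] z that by simp
  qed
  then have small': "\<bar>h (x m) q\<bar> \<le> a" for m by simp
  have "p \<in> {w \<in> topspace X. \<bar>h w q\<bar> \<le> a}"
  proof (rule p)
    show "closedin X {w \<in> topspace X. \<bar>h w q\<bar> \<le> a}"
      by (intro closedin_Collect_le_const continuous_map_real_abs contX qY)
    show "x n \<in> {w \<in> topspace X. \<bar>h w q\<bar> \<le> a}" if "0 \<le> n" for n
      using small' x by simp
  qed
  moreover have "p \<in> {w \<in> topspace X. b \<le> \<bar>h w (z n)\<bar>}" for n
  proof (rule p)
    show "closedin X {w \<in> topspace X. b \<le> \<bar>h w (z n)\<bar>}"
      by (intro closedin_Collect_ge_const continuous_map_real_abs contX z)
    show "x m \<in> {w \<in> topspace X. b \<le> \<bar>h w (z n)\<bar>}" if "n \<le> m" for m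
      using large[OF that] x by simp
  qed
  then have large': "b \<le> \<bar>h p (z n)\<bar>" for n by simp
  have "q \<in> {y \<in> topspace Y. b \<le> \<bar>h p y\<bar>}"
  proof (rule q)
    show "closedin Y {y \<in> topspace Y. b \<le> \<bar>h p y\<bar>}"
      by (intro closedin_Collect_ge_const continuous_map_real_abs contY pX)
    show "z n \<in> {y \<in> topspace Y. b \<le> \<bar>h p y\<bar>}" if "0 \<le> n" for n
      using large' z by simp
  qed
  ultimately show ?thesis by simp
qed

text \<open>Were the conclusion false, one could choose points \<open>z n \<noteq> y\<close> and shrinking open sets with points
  \<open>x n\<close> such that \<open>h (x m) (z n)\<close>, for \<open>h x z = F x z - F x y\<close>, is at least \<open>e\<close> in absolute value
  if \<open>n \<le> m\<close> and below \<open>e / 2\<close> if \<open>m < n\<close>: the latter because \<open>z n\<close> is kept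
  outside the closed set \<open>L m\<close> of points where \<open>h (x m)\<close> is large, which avoids \<open>y\<close> and to which
  the induction hypothesis applies. This contradicts the double limit property.\<close>

lemma small_oscillation_on_add_point:
  fixes F :: "'a \<Rightarrow> 'b \<Rightarrow> real"
  assumes X: "compact_space X" "Hausdorff_space X" and Y: "compact_space Y"
    and contX: "\<And>y. y \<in> topspace Y \<Longrightarrow> continuous_map X euclidean (\<lambda>x. F x y)"
    and contY: "\<And>x. x \<in> topspace X \<Longrightarrow> continuous_map Y euclidean (F x)"
    and K: "closedin Y K" and y: "y \<in> K"
    and IH: "\<And>L. closedin Y L \<Longrightarrow> L \<subseteq> K - {y} \<Longrightarrow> small_oscillation_on X F L"
  shows "small_oscillation_on X F K"
proof (rule ccontr)
  assume "\<not> small_oscillation_on X F K"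
  then obtain U d where U: "openin X U" "U \<noteq> {}" and d: "0 < d"
    and bad: "\<And>V. openin X V \<Longrightarrow> V \<noteq> {} \<Longrightarrow> V \<subseteq> U \<Longrightarrow>
      \<exists>x\<in>V. \<exists>x'\<in>V. \<exists>z\<in>K. d < \<bar>F x z - F x' z\<bar>"
    unfolding small_oscillation_on_def by (metis linorder_not_le)
  \<comment> \<open>Between two points of \<open>U0\<close> the slice of \<open>y\<close> changes by
    less than \<open>2 * e\<close>, so a change above \<open>4 * e\<close> in the slice of
    \<open>z\<close> leaves \<open>e < \<bar>h p z\<bar>\<close> at one of them.\<close>
  define e where "e = d / 4"
  have e: "0 < e" "d = 4 * e" using d by (auto simp: e_def)
  define h where "h x z = F x z - F x y" for x z
  have KY: "K \<subseteq> topspace Y" using K closedin_subset by blast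
  then have yY: "y \<in> topspace Y" using y by blast
  have hX: "continuous_map X euclidean (\<lambda>x. h x z)" if "z \<in> topspace Y" for z
    unfolding h_def using contX that yY by (intro continuous_map_diff) auto
  have hY: "continuous_map Y euclidean (h x)" if "x \<in> topspace X" for x
    unfolding h_def using contY[OF that] by (intro continuous_map_diff) auto
  obtain x0 where x0: "x0 \<in> U" using U by blast
  define U0 where "U0 = U \<inter> {x \<in> topspace X. \<bar>F x y - F x0 y\<bar> < e}"
  have U0: "openin X U0" "U0 \<noteq> {}" "U0 \<subseteq> U"
  proof -
    show "openin X U0"
      unfolding U0_def using U(1) contX[OF yY]
      by (intro openin_Int openin_Collect_less_const continuous_map_abs_diff) auto
    show "U0 \<noteq> {}" using x0 e openin_subset[OF U(1)] by (auto simp: U0_def)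
  qed (auto simp: U0_def)
  \<comment> \<open>By the induction hypothesis the slices from \<open>L\<close> vary by at most
    \<open>e\<close> on some smaller open set, whereas some slice from \<open>K\<close> varies there
    by more than \<open>4 * e\<close>; its parameter \<open>z\<close> is therefore outside
    \<open>L\<close>.\<close>
  have step: "\<exists>z V C. z \<in> K - L \<and> openin X V \<and> V \<noteq> {} \<and> closedin X C \<and> V \<subseteq> C \<and> C \<subseteq> W \<and>
      (\<forall>p\<in>C. e \<le> \<bar>h p z\<bar>)"
    if W: "openin X W" "W \<noteq> {}" "W \<subseteq> U0" and L: "closedin Y L" "L \<subseteq> K - {y}" for W L
  proof -
    obtain V where V: "openin X V" "V \<noteq> {}" "V \<subseteq> W"
      "\<And>x x' z. \<lbrakk>x \<in> V; x' \<in> V; z \<in> L\<rbrakk> \<Longrightarrow> \<bar>F x z - F x' z\<bar> \<le> e"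
      using small_oscillation_onD[OF IH[OF L] W(1,2) e(1)] by metis
    obtain x x' z where z: "x \<in> V" "x' \<in> V" "z \<in> K" "4 * e < \<bar>F x z - F x' z\<bar>"
      using bad[OF V(1,2)] V(3) W(3) U0(3) e(2) by blast
    have "z \<notin> L" using V(4)[of x x' z] z e(1) by force
    have "x \<in> U0" "x' \<in> U0" using z V(3) W(3) by auto
    then have "\<bar>F x y - F x0 y\<bar> < e" "\<bar>F x' y - F x0 y\<bar> < e" by (auto simp: U0_def)
    then have "e < \<bar>h x z\<bar> \<or> e < \<bar>h x' z\<bar>"
      using z(4) unfolding h_def by linarith
    then obtain p where p: "p \<in> V" "e < \<bar>h p z\<bar>" using z by blast
    define T where "T = V \<inter> {x \<in> topspace X. e < \<bar>h x z\<bar>}"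
    have "openin X T"
      unfolding T_def using V(1) hX z(3) KY
      by (intro openin_Int openin_Collect_greater_const continuous_map_real_abs) auto
    moreover have "p \<in> T" using p openin_subset[OF V(1)] by (auto simp: T_def)
    ultimately obtain V' C where "openin X V'" "closedin X C" "p \<in> V'" "V' \<subseteq> C" "C \<subseteq> T"
      using compact_Hausdorff_shrink_open[OF X] by metis
    then show ?thesis
      using z(3) \<open>z \<notin> L\<close> V(3)
      by (intro exI[of _ z] exI[of _ V'] exI[of _ C]) (auto simp: T_def)
  qed
  \<comment> \<open>A state holds an open set \<open>V\<close>, the closed set \<open>L\<close>
    forbidden to later choices of \<open>z\<close>, the chosen points, and a set \<open>C\<close>
    containing \<open>V\<close> on which \<open>h\<close> is large at \<open>z\<close>. Through
    \<open>rel\<close>, \<open>L\<close> also contains the forbidden sets of all earlier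
    states.\<close>
  define inv where "inv = (\<lambda>(V, L, x, z, C).
      openin X V \<and> V \<subseteq> U0 \<and> x \<in> V \<and> V \<subseteq> C \<and> z \<in> K \<and> (\<forall>p\<in>C. e \<le> \<bar>h p z\<bar>) \<and>
      closedin Y L \<and> L \<subseteq> K - {y} \<and> {w \<in> K. e / 2 \<le> \<bar>h x w\<bar>} \<subseteq> L)"
  define rel where "rel = (\<lambda>(V :: 'a set, L :: 'b set, x :: 'a, z :: 'b, C :: 'a set)
      (V' :: 'a set, L' :: 'b set, x' :: 'a, z' :: 'b, C' :: 'a set).
      V' \<subseteq> V \<and> L \<subseteq> L' \<and> z' \<notin> L)"
  have next_state: "\<exists>s'. inv s' \<and> (case s' of (V', L', x', z', C') \<Rightarrow> V' \<subseteq> W \<and> L \<subseteq> L' \<and> z' \<notin> L)"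
    if W: "openin X W" "W \<noteq> {}" "W \<subseteq> U0" and L: "closedin Y L" "L \<subseteq> K - {y}" for W L
  proof -
    obtain z V C where V: "z \<in> K - L" "openin X V" "V \<noteq> {}" "closedin X C" "V \<subseteq> C" "C \<subseteq> W"
      "\<forall>p\<in>C. e \<le> \<bar>h p z\<bar>"
      using step[OF W L] by metis
    obtain x where x: "x \<in> V" using V(3) by blast
    then have xX: "x \<in> topspace X" using V(2) openin_subset by blast
    define M where "M = K \<inter> {w \<in> topspace Y. e / 2 \<le> \<bar>h x w\<bar>}"
    have "closedin Y M"
      unfolding M_def
      by (intro closedin_Int K closedin_Collect_ge_const continuous_map_real_abs hY xX)
    have "M \<subseteq> K - {y}" using e(1) by (auto simp: M_def h_def)
    have "{w \<in> K. e / 2 \<le> \<bar>h x w\<bar>} \<subseteq> M" using KY by (auto simp: M_def)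
    have "inv (V, L \<union> M, x, z, C)"
      unfolding inv_def prod.case
    proof (intro conjI)
      show "V \<subseteq> U0" using V(5,6) W(3) by (meson subset_trans)
      show "z \<in> K" using V(1) by simp
      show "closedin Y (L \<union> M)" by (intro closedin_Un L(1) \<open>closedin Y M\<close>)
      show "L \<union> M \<subseteq> K - {y}" using L(2) \<open>M \<subseteq> K - {y}\<close> by (rule Un_least)
      show "{w \<in> K. e / 2 \<le> \<bar>h x w\<bar>} \<subseteq> L \<union> M"
        using \<open>{w \<in> K. e / 2 \<le> \<bar>h x w\<bar>} \<subseteq> M\<close> by (rule le_supI2)
    qed (fact V x)+
    moreover have "V \<subseteq> W" using V(5,6) by (rule subset_trans)
    ultimately show ?thesis
      using V(1) by (intro exI[of _ "(V, L \<union> M, x, z, C)"]) simp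
  qed
  have "\<exists>s. \<forall>n. inv (s n) \<and> rel (s n) (s (Suc n))"
  proof (rule dependent_nat_choice)
    show "\<exists>s. inv s" using next_state[OF U0(1,2) order_refl, of "{}"] by (metis closedin_empty empty_subsetI)
  next
    fix s and n :: nat assume "inv s"
    obtain V L x z C where s: "s = (V, L, x, z, C)" by (cases s)
    have "openin X V" "V \<noteq> {}" "V \<subseteq> U0" "closedin Y L" "L \<subseteq> K - {y}"
      using \<open>inv s\<close> unfolding s inv_def by auto
    from next_state[OF this] show "\<exists>s'. inv s' \<and> rel s s'"
      unfolding rel_def s by simp
  qed
  then obtain s where s: "\<And>n. inv (s n)" "\<And>n. rel (s n) (s (Suc n))" by blast
  define V where "V n = fst (s n)" for n
  define L where "L n = fst (snd (s n))" for n
  define x where "x n = fst (snd (snd (s n)))" for n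
  define z where "z n = fst (snd (snd (snd (s n))))" for n
  define C where "C n = snd (snd (snd (snd (s n))))" for n
  note defs = V_def L_def x_def z_def C_def
  have inv_n: "openin X (V n)" "x n \<in> V n" "V n \<subseteq> C n" "z n \<in> K" "\<And>p. p \<in> C n \<Longrightarrow> e \<le> \<bar>h p (z n)\<bar>"
    "\<And>w. w \<in> K \<Longrightarrow> e / 2 \<le> \<bar>h (x n) w\<bar> \<Longrightarrow> w \<in> L n" for n
    using s(1)[of n] unfolding inv_def defs by (auto split: prod.splits)
  have rel_n: "V (Suc n) \<subseteq> V n" "L n \<subseteq> L (Suc n)" "z (Suc n) \<notin> L n" for n
    using s(2)[of n] unfolding rel_def defs by (auto split: prod.splits)
  have V_anti: "V n \<subseteq> V m" if "m \<le> n" for m n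
    using lift_Suc_antimono_le[of V] rel_n(1) that by blast
  have L_mono: "L m \<subseteq> L n" if "m \<le> n" for m n
    using lift_Suc_mono_le[of L] rel_n(2) that by blast
  have "e \<le> e / 2"
  proof (rule double_limit_separation[OF X(1) Y hX hY, of x z])
    show "x n \<in> topspace X" for n using inv_n(1,2) openin_subset by blast
    show "z n \<in> topspace Y" for n using inv_n(4) KY by blast
    show "\<bar>h (x m) (z n)\<bar> \<le> e / 2" if mn: "m < n" for m n
    proof -
      \<comment> \<open>\<open>z n\<close> avoids the forbidden set of the preceding state only,
        hence the shift to \<open>k\<close>; that set contains \<open>L m\<close>.\<close>
      obtain k where k: "n = Suc k" "m \<le> k" using mn by (cases n) auto
      then have "z n \<notin> L m" using rel_n(3)[of k] L_mono[of m k] by blast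
      then show ?thesis using inv_n(6)[of "z n" m] inv_n(4)[of n] by force
    qed
    show "e \<le> \<bar>h (x m) (z n)\<bar>" if "n \<le> m" for m n
      using inv_n(2)[of m] inv_n(3)[of n] inv_n(5)[of "x m" n] V_anti[OF that] by blast
  qed
  then show False using e(1) by simp
qed

lemma small_oscillation_scattered:
  fixes F :: "'a \<Rightarrow> 'b \<Rightarrow> real"
  assumes X: "compact_space X" "Hausdorff_space X"
    and Y: "compact_space Y" "Hausdorff_space Y" "scattered_space Y"
    and contX: "\<And>y. y \<in> topspace Y \<Longrightarrow> continuous_map X euclidean (\<lambda>x. F x y)"
    and contY: "\<And>x. x \<in> topspace X \<Longrightarrow> continuous_map Y euclidean (F x)"
  shows "small_oscillation_on X F (topspace Y)"
proof (rule scattered_closed_induct[OF Y])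
  show "small_oscillation_on X F {}" by (auto simp: small_oscillation_on_def)
  show "small_oscillation_on X F L" if K: "small_oscillation_on X F K" "L \<subseteq> K" for K L
    unfolding small_oscillation_on_def
  proof (intro allI impI)
    fix U and e :: real assume "openin X U \<and> U \<noteq> {} \<and> 0 < e"
    then obtain V where "openin X V" "V \<noteq> {}" "V \<subseteq> U"
      "\<And>x x' y. \<lbrakk>x \<in> V; x' \<in> V; y \<in> K\<rbrakk> \<Longrightarrow> \<bar>F x y - F x' y\<bar> \<le> e"
      using small_oscillation_onD[OF K(1)] by metis
    then show "\<exists>V. openin X V \<and> V \<noteq> {} \<and> V \<subseteq> U \<and>
        (\<forall>x\<in>V. \<forall>x'\<in>V. \<forall>y\<in>L. \<bar>F x y - F x' y\<bar> \<le> e)"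
      using K(2) by (intro exI[of _ V]) (auto dest: subsetD)
  qed
qed (auto intro: small_oscillation_on_Un small_oscillation_on_add_point[OF X Y(1) contX contY])

text \<open>A difference of two slices persists on an open set, which contains an open set of small
  oscillation. By maximality the latter meets a member of the chosen family, and the difference
  would carry over to the point chosen there.\<close>

lemma ccc_points_separate_slices:
  fixes F :: "'a \<Rightarrow> 'b \<Rightarrow> real"
  assumes X: "ccc_space X"
    and contX: "\<And>y. y \<in> topspace Y \<Longrightarrow> continuous_map X euclidean (\<lambda>x. F x y)"
    and osc: "small_oscillation_on X F (topspace Y)"
  obtains E where "countable E" "E \<subseteq> topspace X"
    "\<And>y y' x. \<lbrakk>y \<in> topspace Y; y' \<in> topspace Y; x \<in> topspace X;
      \<forall>e\<in>E. F e y = F e y'\<rbrakk> \<Longrightarrow> F x y = F x y'"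
proof -
  define \<P> where "\<P> n = {V. openin X V \<and> V \<noteq> {} \<and>
    (\<forall>x\<in>V. \<forall>x'\<in>V. \<forall>y\<in>topspace Y. \<bar>F x y - F x' y\<bar> \<le> inverse (Suc n))}" for n :: nat
  have "\<forall>n. \<exists>M. M \<subseteq> \<P> n \<and> pairwise disjnt M \<and> (\<forall>V\<in>\<P> n. \<exists>W\<in>M. \<not> disjnt V W)"
    by (intro allI exists_maximal_disjoint_subfamily) (simp add: \<P>_def)
  from choice[OF this] obtain M where
    "\<forall>n. M n \<subseteq> \<P> n \<and> pairwise disjnt (M n) \<and> (\<forall>V\<in>\<P> n. \<exists>W\<in>M n. \<not> disjnt V W)"
    by (rule exE)
  then have M: "\<And>n. M n \<subseteq> \<P> n" "\<And>n. pairwise disjnt (M n)"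
    "\<And>n V. V \<in> \<P> n \<Longrightarrow> \<exists>W\<in>M n. \<not> disjnt V W"
    by simp_all
  have M_open: "openin X V" "V \<noteq> {}" if "V \<in> M n" for V n
    using subsetD[OF M(1) that] by (simp_all add: \<P>_def)
  have "countable (M n)" for n
    by (intro X[unfolded ccc_space_def, rule_format, of "M n"] conjI ballI M(2)) (fact M_open)+
  define c where "c V = (SOME x. x \<in> V)" for V :: "'a set"
  have c: "c V \<in> V" if "V \<in> M n" for V n
    unfolding c_def using M_open(2)[OF that] by (simp add: some_in_eq)
  show thesis
  proof
    show "countable (\<Union>n. c ` M n)" using \<open>\<And>n. countable (M n)\<close> by auto
    show "(\<Union>n. c ` M n) \<subseteq> topspace X"
      using subsetD[OF openin_subset[OF M_open(1)] c] by auto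
    fix y y' x
    assume y: "y \<in> topspace Y" "y' \<in> topspace Y" and x: "x \<in> topspace X"
      and eq: "\<forall>e\<in>(\<Union>n. c ` M n). F e y = F e y'"
    show "F x y = F x y'"
    proof (rule ccontr)
      assume "F x y \<noteq> F x y'"
      \<comment> \<open>Halving leaves room for two errors: moving from \<open>w\<close> to the
        chosen point of \<open>W\<close> costs \<open>inverse (Suc n)\<close> in each of the two
        slices.\<close>
      then have "0 < \<bar>F x y - F x y'\<bar> / 2" by simp
      then obtain n where n: "inverse (Suc n) < \<bar>F x y - F x y'\<bar> / 2"
        using reals_Archimedean by blast
      define U where "U = {w \<in> topspace X. 2 * inverse (Suc n) < \<bar>F w y - F w y'\<bar>}"
      have "openin X U"
        unfolding U_def using contX y by (intro openin_Collect_greater_const continuous_map_abs_diff)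
      moreover have "U \<noteq> {}" using x n by (auto simp: U_def)
      ultimately obtain V where V: "openin X V" "V \<noteq> {}" "V \<subseteq> U"
        "\<And>x x' y. \<lbrakk>x \<in> V; x' \<in> V; y \<in> topspace Y\<rbrakk> \<Longrightarrow> \<bar>F x y - F x' y\<bar> \<le> inverse (Suc n)"
        using small_oscillation_onD[OF osc, of U "inverse (Suc n)"] by auto
      then have "V \<in> \<P> n" by (simp add: \<P>_def)
      then obtain W where W: "W \<in> M n" "\<not> disjnt V W" using M(3) by blast
      then obtain w where w: "w \<in> V" "w \<in> W" by (auto simp: disjnt_iff)
      have "W \<in> \<P> n" using W(1) M(1) by blast
      then have "\<bar>F w y - F (c W) y\<bar> \<le> inverse (Suc n)" "\<bar>F w y' - F (c W) y'\<bar> \<le> inverse (Suc n)"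
        using c[OF W(1)] w(2) y by (simp_all add: \<P>_def)
      moreover have "F (c W) y = F (c W) y'" using eq W(1) by blast
      ultimately have "\<bar>F w y - F w y'\<bar> \<le> 2 * inverse (Suc n)" by linarith
      moreover have "w \<in> U" using w V(3) by blast
      ultimately show False by (simp add: U_def)
    qed
  qed
qed

section \<open>From countably many slices to the stable pair\<close>

text \<open>The slices at an enumeration of \<open>C\<close> serve as \<open>u n\<close>. Each
  \<open>f x\<close> attains its extrema on the compact \<open>Y\<close>, and every value of
  \<open>f x\<close> is a value of some \<open>u n\<close>.\<close>

lemma stable_Hahn_pair_if_countable_slices:
  fixes f :: "'a \<Rightarrow> 'b \<Rightarrow> ereal"
  assumes Y: "compact_space Y" "topspace Y \<noteq> {}" and f: "separately_continuous X Y f"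
    and C: "countable C" "C \<subseteq> topspace Y"
    and slices: "\<And>y. y \<in> topspace Y \<Longrightarrow> \<exists>c\<in>C. \<forall>x\<in>topspace X. f x y = f x c"
  shows "stable_Hahn_pair X (inf_f Y f) (sup_f Y f)"
proof -
  have "C \<noteq> {}" using Y(2) slices by blast
  define u where "u n x = f x (from_nat_into C n)" for n x
  have inC: "from_nat_into C n \<in> C" for n using \<open>C \<noteq> {}\<close> by (rule from_nat_into)
  have u_slice: "\<exists>n. u n x = f x y" if xy: "x \<in> topspace X" "y \<in> topspace Y" for x y
  proof -
    obtain c where "c \<in> C" "f x y = f x c" using slices xy by blast
    then show ?thesis
      using from_nat_into_surj[OF C(1)] unfolding u_def by metis
  qed
  show ?thesis
    unfolding stable_Hahn_pair_def
  proof (intro exI[of _ u] conjI allI ballI)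
    show "continuous_map X euclidean (u n)" for n
      using f inC[of n] C(2) unfolding u_def separately_continuous_def by blast
  next
    fix x assume x: "x \<in> topspace X"
    have "continuous_map Y euclidean (f x)"
      using f x unfolding separately_continuous_def by simp
    then have cpt: "compact (f x ` topspace Y)" "f x ` topspace Y \<noteq> {}"
      using image_compactin[of Y "topspace Y" euclidean "f x"] Y by (auto simp: compact_space_def)
    obtain a where a: "a \<in> topspace Y" "\<forall>y\<in>topspace Y. f x a \<le> f x y"
      using compact_attains_inf[OF cpt] by blast
    then have "inf_f Y f x = f x a"
      unfolding inf_f_def by (intro antisym INF_lower INF_greatest) auto
    then show "\<exists>n. u n x = inf_f Y f x" using u_slice[OF x a(1)] by simp
    obtain b where b: "b \<in> topspace Y" "\<forall>y\<in>topspace Y. f x y \<le> f x b"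
      using compact_attains_sup[OF cpt] by blast
    then have "sup_f Y f x = f x b"
      unfolding sup_f_def by (intro antisym SUP_upper SUP_least) auto
    then show "\<exists>n. u n x = sup_f Y f x" using u_slice[OF x b(1)] by simp
    fix n
    have "from_nat_into C n \<in> topspace Y" using inC C(2) by blast
    then show "inf_f Y f x \<le> u n x" "u n x \<le> sup_f Y f x"
      unfolding u_def inf_f_def sup_f_def by (auto intro: INF_lower SUP_upper)
  qed
qed

theorem theorem4p3:
  fixes X :: "'a topology" and Y :: "'b topology" and f :: "'a \<Rightarrow> 'b \<Rightarrow> ereal"
  assumes "compact_space X" and "Hausdorff_space X"
    and "compact_space Y" and "Hausdorff_space Y"
    and "topspace Y \<noteq> {}"
    and "scattered_space Y"
    and "ccc_space X \<or> ccc_space Y"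
    and "separately_continuous X Y f"
  shows "stable_Hahn_pair X (inf_f Y f) (sup_f Y f)"
proof -
  \<comment> \<open>Continuity of the squashing carries separate continuity over to
    \<open>F\<close>; its injectivity brings equality of slices back to \<open>f\<close> at the
    end.\<close>
  define F where "F x y = ereal_squash (f x y)" for x y
  have squash: "continuous_map euclidean euclidean ereal_squash"
    using continuous_ereal_squash by simp
  have contX: "continuous_map X euclidean (\<lambda>x. F x y)" if "y \<in> topspace Y" for y
    using continuous_map_compose[OF _ squash, of X "\<lambda>x. f x y"] assms(8) that
    unfolding separately_continuous_def F_def by (simp add: o_def)
  have contY: "continuous_map Y euclidean (F x)" if "x \<in> topspace X" for x
    using continuous_map_compose[OF _ squash, of Y "f x"] assms(8) that
    unfolding separately_continuous_def F_def by (simp add: o_def)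
  obtain E where E: "countable E" "E \<subseteq> topspace X"
    "\<And>y y' x. \<lbrakk>y \<in> topspace Y; y' \<in> topspace Y; x \<in> topspace X;
      \<forall>e\<in>E. F e y = F e y'\<rbrakk> \<Longrightarrow> F x y = F x y'"
    using assms(7)
  proof
    assume "ccc_space X"
    then show thesis
      using ccc_points_separate_slices[of X Y F, OF _ contX
          small_oscillation_scattered[OF assms(1-4,6) contX contY]] that by metis
  next
    assume "ccc_space Y"
    then obtain D where "countable D" "D \<subseteq> topspace Y" "Y closure_of D = topspace Y"
      using scattered_ccc_countable_dense[OF assms(6)] by metis
    then show thesis
      using dense_points_separate_slices[of X Y F D, OF assms(1) contX contY] assms(5) that by metis
  qed
  let ?g = "\<lambda>y. restrict (\<lambda>x. F x y) (topspace X)"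
  have "countable (?g ` topspace Y)"
    by (rule countable_slices_if_separated[OF assms(3,4,6) contY E])
  \<comment> \<open>Countably many parameters \<open>C\<close> already produce every slice.\<close>
  then obtain C where C: "countable C" "C \<subseteq> topspace Y" "?g ` topspace Y = ?g ` C"
    using countable_subset_image[of "?g ` topspace Y" ?g "topspace Y"] by auto
  show ?thesis
  proof (rule stable_Hahn_pair_if_countable_slices[OF assms(3,5,8) C(1,2)])
    fix y assume "y \<in> topspace Y"
    then obtain c where c: "c \<in> C" "?g y = ?g c" using C(3) by blast
    have "f x y = f x c" if "x \<in> topspace X" for x
      using fun_cong[OF c(2), of x] that inj_ereal_squash by (simp add: F_def inj_eq)
    then show "\<exists>c\<in>C. \<forall>x\<in>topspace X. f x y = f x c" using c(1) by blast
  qed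
qed

end
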